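(* Let $m,k,d\in\mathbb{N}$ with $k\le m$, and suppose that $X=\mathbb{R}^d$. Let $f_i:X\to\left]-\infty,+\infty\right]$ be a polyhedrally convex function for every $i\in\{1,2,\ldots,k\}$, and let $f_j:X\to\left]-\infty,+\infty\right]$ be proper and convex for every $j\in\{k+1,k+2,\ldots,m\}$. Assume that there exists $x_0\in \bigcap_{i=1}^m\operatorname{dom} f_i$ such that $f_i$ is continuous at $x_0$ for every $i\in\{k+1,k+2,\ldots,m\}$. Then $\left(\sum_{i=1}^m f_i\right)^*=f_1^*\Box\cdots \Box f_m^*$ in $X^*$ and the infimal convolution is exact everywhere. Furthermore, $$\partial (f_1+f_2+\cdots+f_m)=\partial f_1+\cdots+\partial f_m.$$
   Context: A polyhedral set is a finite intersection of (closed) halfspaces, and a function $f:X\to\left]-\infty,+\infty\right]$ is polyhedrally convex if its epigraph $\operatorname{epi} f=\{(x,r)\in X\times\mathbb{R}: f(x)\le r\}$ is a polyhedral set. For $f:X\to\left]-\infty,+\infty\right]$: $\operatorname{dom} f=\{x: f(x)<+\infty\}$; $f$ is proper if $\operatorname{dom} f\neq\varnothing$; the Fenchel conjugate is $f^*(x^* )=\sup_{x\in X}\{\langle x,x^*\rangle-f(x)\}$ for $x^*\in X^*$; $\partial f(x)=\{x^*\in X^*: \langle y-x,x^*\rangle+f(x)\le f(y)\ \ \forall y\in X\}$ if $f(x)\in\mathbb{R}$, and $\partial f(x)=\varnothing$ otherwise. Equality of subdifferentials means equality at every point of $X$, the right-hand side being the pointwise Minkowski sum. The infimal convolution is $(f_1^*\Box\cdots\Box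 f_m^* )(z^* )=\inf\{f_1^*(z_1^* )+\cdots+f_m^*(z_m^* ): z_1^*+\cdots+z_m^*=z^*\}$; it is exact at $z^*$ if this infimum is attained. *)

theory Defs
  imports "HOL-Analysis.Analysis" "HOL-Library.Set_Algebras"
begin

text \<open>
  Functions \<open>X \<rightarrow> ]-\<infinity>, +\<infinity>]\<close> are represented as functions into \<^typ>\<open>ereal\<close>; that the
  value \<open>-\<infinity>\<close> is not taken is a separate hypothesis. The dual space \<open>X\<^sup>*\<close> is the
  type of bounded linear functionals \<open>'a \<Rightarrow>\<^sub>L real\<close>, with pairing \<^const>\<open>blinfun_apply\<close>.
\<close>

definition edom :: "('a \<Rightarrow> ereal) \<Rightarrow> 'a set" where
  "edom f = {x. f x < \<infinity>}"

definition proper_fun :: "('a \<Rightarrow> ereal) \<Rightarrow> bool" where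
  "proper_fun f \<longleftrightarrow> edom f \<noteq> {}"

text \<open>The library's \<^const>\<open>epigraph\<close> and \<^const>\<open>convex_on\<close> are for real-valued functions only.\<close>

definition eepigraph :: "('a \<Rightarrow> ereal) \<Rightarrow> ('a \<times> real) set" where
  "eepigraph f = {(x, r). f x \<le> ereal r}"

definition polyhedrally_convex :: "('a::euclidean_space \<Rightarrow> ereal) \<Rightarrow> bool" where
  "polyhedrally_convex f \<longleftrightarrow> polyhedron (eepigraph f)"

definition econvex :: "('a::real_vector \<Rightarrow> ereal) \<Rightarrow> bool" where
  "econvex f \<longleftrightarrow> (\<forall>x y t. 0 < t \<longrightarrow> t < 1 \<longrightarrow>
     f ((1 - t) *\<^sub>R x + t *\<^sub>R y) \<le> ereal (1 - t) * f x + ereal t * f y)"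

definition fenchel_conjugate ::
  "('a::real_normed_vector \<Rightarrow> ereal) \<Rightarrow> ('a \<Rightarrow>\<^sub>L real) \<Rightarrow> ereal" where
  "fenchel_conjugate f xs = (SUP x. ereal (blinfun_apply xs x) - f x)"

definition subdifferential ::
  "('a::real_normed_vector \<Rightarrow> ereal) \<Rightarrow> 'a \<Rightarrow> ('a \<Rightarrow>\<^sub>L real) set" where
  "subdifferential f x =
     (if \<bar>f x\<bar> \<noteq> \<infinity>
      then {xs. \<forall>y. ereal (blinfun_apply xs (y - x)) + f x \<le> f y}
      else {})"

definition inf_convolution ::
  "'i set \<Rightarrow> ('i \<Rightarrow> 'b::comm_monoid_add \<Rightarrow> ereal) \<Rightarrow> 'b \<Rightarrow> ereal" where
  "inf_convolution I g z = Inf {\<Sum>i\<in>I. g i (w i) | w. (\<Sum>i\<in>I. w i) = z}"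

text \<open>The attained value may be \<open>+\<infinity>\<close>.\<close>

definition inf_convolution_exact_at ::
  "'i set \<Rightarrow> ('i \<Rightarrow> 'b::comm_monoid_add \<Rightarrow> ereal) \<Rightarrow> 'b \<Rightarrow> bool" where
  "inf_convolution_exact_at I g z \<longleftrightarrow>
     (\<exists>w. (\<Sum>i\<in>I. w i) = z \<and> (\<Sum>i\<in>I. g i (w i)) = inf_convolution I g z)"

end

theory Submission
  imports Defs
begin

text \<open>
  Exactness of the infimal convolution and the subdifferential sum rule both reduce to one
  statement about affine minorants: if \<open>\<langle>x, z\<rangle> - \<alpha> \<le> f\<^sub>1 x + \<dots> + f\<^sub>m x\<close> for all \<open>x\<close>, then
  \<open>z = w\<^sub>1 + \<dots> + w\<^sub>m\<close> and \<open>c\<^sub>1 + \<dots> + c\<^sub>m \<le> \<alpha>\<close> with \<open>\<langle>x, w\<^sub>i\<rangle> - c\<^sub>i \<le> f\<^sub>i x\<close>. This is proved by adding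
  one summand at a time, the polyhedral ones first. While all summands are polyhedral, so is the
  partial sum, and the two constraint systems are separated by Farkas' lemma (finitely generated
  cones are closed). When a continuous summand \<open>g\<close> is added to a convex partial sum \<open>f\<close>, the
  epigraph of \<open>f\<close> is separated from the strict hypograph of \<open>\<langle>\<cdot>, z\<rangle> - \<alpha> - g\<close>; the hyperplane is
  not vertical because \<open>x\<^sub>0\<close> is interior to the domain of \<open>g\<close>.
\<close>

section \<open>Farkas' lemma and intersections of polyhedra\<close>

text \<open>The cone is finitely generated, hence closed, so a point outside it can be strictly
  separated by some \<open>(v, t)\<close> that is nonnegative on the cone. If \<open>t > 0\<close>,
  rescaling \<open>v\<close> gives a feasible point violating the inequality. If
  \<open>t = 0\<close>, then \<open>- v\<close> is a recession direction of the feasible set along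
  which \<open>a\<close> grows without bound. The generator \<open>(0, 1)\<close> permits weakening
  of right-hand sides.\<close>

lemma farkas:
  fixes C :: "('a::euclidean_space \<times> real) set"
  assumes fin: "finite C"
    and x0: "\<forall>(p, q)\<in>C. p \<bullet> x0 \<le> q"
    and imp: "\<And>x. \<forall>(p, q)\<in>C. p \<bullet> x \<le> q \<Longrightarrow> a \<bullet> x \<le> b"
  shows "(a, b) \<in> convex_cone hull (insert (0, 1) C)"
proof (rule ccontr)
  let ?K = "convex_cone hull (insert (0, 1) C)"
  assume "(a, b) \<notin> ?K"
  then obtain y \<beta> where ab: "y \<bullet> (a, b) < \<beta>" and K: "\<forall>k\<in>?K. y \<bullet> k > \<beta>"
    using separating_hyperplane_closed_point[of ?K "(a, b)"] fin
    by (auto simp: convex_convex_cone_hull closed_convex_cone_hull)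
  obtain v t where y: "y = (v, t)" by fastforce
  have "\<beta> < 0"
    using K convex_cone_hull_contains_0 by fastforce
  \<comment> \<open>A negative value at \<open>k\<close> could be scaled, inside the cone, to
    exactly \<beta>, contradicting the strict separation.\<close>
  have nonneg: "y \<bullet> k \<ge> 0" if "k \<in> ?K" for k
  proof (rule ccontr)
    assume neg: "\<not> 0 \<le> y \<bullet> k"
    then have "(\<beta> / (y \<bullet> k)) *\<^sub>R k \<in> ?K"
      using that \<open>\<beta> < 0\<close> by (intro convex_cone_hull_mul) (auto simp: divide_nonpos_nonpos)
    then show False using K neg by fastforce
  qed
  have t: "t \<ge> 0" using nonneg[of "(0, 1)"] y by (simp add: hull_inc)
  have C: "v \<bullet> p + t * q \<ge> 0" if "(p, q) \<in> C" for p q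
    using nonneg[of "(p, q)"] that y by (simp add: hull_inc)
  have neg: "v \<bullet> a + t * b < 0" using ab \<open>\<beta> < 0\<close> y by simp
  show False
  proof (cases "t = 0")
    case False
    then have t': "t > 0" using t by simp
    \<comment> \<open>Dividing the separating functional by \<open>t\<close> turns its nonnegativity
      on \<open>C\<close> into feasibility of \<open>- v / t\<close>.\<close>
    have "a \<bullet> ((- 1 / t) *\<^sub>R v) \<le> b"
    proof (rule imp, clarify)
      fix p q assume "(p, q) \<in> C"
      from C[OF this] show "p \<bullet> ((- 1 / t) *\<^sub>R v) \<le> q"
        using t' by (simp add: field_simps inner_commute)
    qed
    then show False using neg t' by (simp add: field_simps inner_commute)
  next
    case True
    \<comment> \<open>Moving from \<open>x0\<close> by \<open>l\<close> along \<open>- v\<close>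
      raises the value of \<open>a\<close> by \<open>\<bar>b - a \<bullet> x0\<bar> + 1\<close>,
      which overshoots \<open>b\<close>.\<close>
    define l where "l = (\<bar>b - a \<bullet> x0\<bar> + 1) / - (v \<bullet> a)"
    have va: "v \<bullet> a < 0" using neg True by simp
    have l: "l \<ge> 0" unfolding l_def using va by (intro divide_nonneg_pos) auto
    have "a \<bullet> (x0 - l *\<^sub>R v) \<le> b"
    proof (rule imp, clarify)
      fix p q assume pq: "(p, q) \<in> C"
      have "p \<bullet> x0 \<le> q" using x0 pq by auto
      moreover have "l * (v \<bullet> p) \<ge> 0" using C[OF pq] True l by simp
      ultimately show "p \<bullet> (x0 - l *\<^sub>R v) \<le> q" by (simp add: inner_diff_right inner_commute)
    qed
    moreover have "l * (v \<bullet> a) = - (\<bar>b - a \<bullet> x0\<bar> + 1)" using va by (simp add: l_def)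
    ultimately show False by (simp add: inner_diff_right inner_commute)
  qed
qed

text \<open>For a fixed \<open>x\<close>, the inequalities satisfied at \<open>x\<close> form a
  convex cone of pairs, which contains all the generators.\<close>

lemma convex_cone_hull_valid:
  fixes C :: "('a::real_inner \<times> real) set"
  assumes "(a, b) \<in> convex_cone hull (insert (0, 1) C)" and x: "\<forall>(p, q)\<in>C. p \<bullet> x \<le> q"
  shows "a \<bullet> x \<le> b"
proof -
  let ?H = "{(p, q). p \<bullet> x \<le> q} :: ('a \<times> real) set"
  have "convex_cone ?H"
    unfolding convex_cone_iff
    by (auto simp: inner_add_left zero_prod_def intro: add_mono mult_left_mono)
  then have "convex_cone hull (insert (0, 1) C) \<subseteq> ?H"
    using x by (intro hull_minimal) auto
  then show ?thesis using assms(1) by auto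
qed

text \<open>Zero normals are allowed here, unlike in \<open>polyhedron_def\<close>, so normals can
  be added, projected or padded without checking that they stay nonzero.\<close>

lemma polyhedron_iff_system:
  fixes P :: "'a::euclidean_space set"
  shows "polyhedron P \<longleftrightarrow> (\<exists>C. finite C \<and> P = {x. \<forall>(p, q)\<in>C. p \<bullet> x \<le> q})"
proof
  assume "polyhedron P"
  then obtain F where F: "finite F" "P = \<Inter>F" "\<forall>h\<in>F. \<exists>a b. a \<noteq> 0 \<and> h = {x. a \<bullet> x \<le> b}"
    unfolding polyhedron_def by blast
  then obtain A B where AB: "\<forall>h\<in>F. h = {x. A h \<bullet> x \<le> B h}" by metis
  have "P = {x. \<forall>(p, q)\<in>(\<lambda>h. (A h, B h)) ` F. p \<bullet> x \<le> q}"
    using F(2) AB by auto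
  then show "\<exists>C. finite C \<and> P = {x. \<forall>(p, q)\<in>C. p \<bullet> x \<le> q}"
    using F(1) by (intro exI[of _ "(\<lambda>h. (A h, B h)) ` F"]) auto
next
  assume "\<exists>C. finite C \<and> P = {x. \<forall>(p, q)\<in>C. p \<bullet> x \<le> q}"
  then obtain C where C: "finite C" "P = {x. \<forall>(p, q)\<in>C. p \<bullet> x \<le> q}" by blast
  have "P = \<Inter> ((\<lambda>(p, q). {x. p \<bullet> x \<le> q}) ` C)" using C(2) by auto
  moreover have "polyhedron \<dots>"
    using C(1) by (intro polyhedron_Inter) (auto simp: polyhedron_halfspace_le)
  ultimately show "polyhedron P" by simp
qed

text \<open>A Farkas certificate for the joint system is a sum of one certificate for each system,
  because the cone generated by a union is the sum of the two cones.\<close>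

lemma polyhedron_Int_split:
  fixes P Q :: "'a::euclidean_space set"
  assumes "polyhedron P" "polyhedron Q" "P \<inter> Q \<noteq> {}"
    and "\<And>x. x \<in> P \<Longrightarrow> x \<in> Q \<Longrightarrow> a \<bullet> x \<le> b"
  obtains p q where "\<And>x. x \<in> P \<Longrightarrow> p \<bullet> x \<le> q" "\<And>x. x \<in> Q \<Longrightarrow> (a - p) \<bullet> x \<le> b - q"
proof -
  obtain C D where C: "finite C" "P = {x. \<forall>(p, q)\<in>C. p \<bullet> x \<le> q}"
    and D: "finite D" "Q = {x. \<forall>(p, q)\<in>D. p \<bullet> x \<le> q}"
    using assms(1,2) unfolding polyhedron_iff_system by blast
  obtain x0 where "x0 \<in> P" "x0 \<in> Q" using assms(3) by blast
  then have "(a, b) \<in> convex_cone hull (insert (0, 1) (C \<union> D))"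
    using C D assms(4) by (intro farkas[of _ x0]) auto
  \<comment> \<open>The slack generator is duplicated so that each of the two cones has its
    own.\<close>
  also have "insert (0, 1) (C \<union> D) = insert (0, 1) C \<union> insert (0, 1) D" by auto
  finally obtain p q p' q' where *: "(p, q) \<in> convex_cone hull (insert (0, 1) C)"
      "(p', q') \<in> convex_cone hull (insert (0, 1) D)" "(a, b) = (p, q) + (p', q')"
    unfolding convex_cone_hull_Un by fast
  show ?thesis
  proof
    show "p \<bullet> x \<le> q" if "x \<in> P" for x
      using convex_cone_hull_valid[OF *(1)] that C(2) by auto
    have "a - p = p'" "b - q = q'" using *(3) by auto
    then show "(a - p) \<bullet> x \<le> b - q" if "x \<in> Q" for x
      using convex_cone_hull_valid[OF *(2)] that D(2) by auto
  qed
qed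

section \<open>Splitting affine minorants of a polyhedral sum\<close>

text \<open>On its domain, \<open>f\<close> is a maximum of finitely many affine functions. Epigraph
  constraints with negative coefficient of \<open>r\<close> are scaled to coefficient -1 and give
  the pieces \<open>S\<close>; those with coefficient 0 cut out the domain and form
  \<open>T\<close>.\<close>

lemma polyhedrally_convex_normal_form:
  fixes f :: "'a::euclidean_space \<Rightarrow> ereal"
  assumes "polyhedrally_convex f" and ninf: "\<And>x. f x \<noteq> -\<infinity>" and x0: "f x0 < \<infinity>"
  obtains S T where "finite S" "S \<noteq> {}" "finite T"
    "\<And>x r. f x \<le> ereal r \<longleftrightarrow> (\<forall>(p, q)\<in>S. p \<bullet> x - q \<le> r) \<and> (\<forall>(p, q)\<in>T. p \<bullet> x \<le> q)"
proof -
  obtain C where C: "finite C" "eepigraph f = {y. \<forall>(p, q)\<in>C. p \<bullet> y \<le> q}"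
    using assms(1) unfolding polyhedrally_convex_def polyhedron_iff_system by blast
  have epi: "f x \<le> ereal r \<longleftrightarrow> (\<forall>(p, q)\<in>C. p \<bullet> (x, r) \<le> q)" for x r
    using C(2) unfolding eepigraph_def by auto
  obtain r0 where r0: "f x0 = ereal r0"
    using ninf[of x0] x0 by (cases "f x0") auto
  have slope: "\<beta> \<le> 0" if "((p, \<beta>), c) \<in> C" for p \<beta> c
  proof (rule ccontr)
    assume "\<not> \<beta> \<le> 0"
    then have \<beta>: "\<beta> > 0" by simp
    \<comment> \<open>Raising \<open>r0\<close> by \<open>s\<close> increases the left-hand side by
      more than the slack of the constraint at \<open>(x0, r0)\<close>, yet the epigraph is closed
      under raising \<open>r\<close>.\<close>
    define s where "s = (\<bar>c - p \<bullet> x0 - \<beta> * r0\<bar> + 1) / \<beta>"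
    have "s \<ge> 0" using \<beta> by (simp add: s_def)
    then have "f x0 \<le> ereal (r0 + s)" using r0 by simp
    then have "p \<bullet> x0 + \<beta> * r0 + \<beta> * s \<le> c"
      unfolding epi using that by (auto simp: algebra_simps)
    moreover have "\<beta> * s = \<bar>c - p \<bullet> x0 - \<beta> * r0\<bar> + 1" using \<beta> by (simp add: s_def)
    ultimately show False by linarith
  qed
  define S where "S = (\<lambda>((p, \<beta>), c). ((1 / - \<beta>) *\<^sub>R p, c / - \<beta>)) ` {((p, \<beta>), c) \<in> C. \<beta> < 0}"
  define T where "T = (\<lambda>((p, \<beta>), c). (p, c)) ` {((p, \<beta>), c) \<in> C. \<beta> = 0}"
  have ST: "f x \<le> ereal r \<longleftrightarrow> (\<forall>(p, q)\<in>S. p \<bullet> x - q \<le> r) \<and> (\<forall>(p, q)\<in>T. p \<bullet> x \<le> q)" for x r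
  proof -
    have eq: "(p \<bullet> x + \<beta> * r \<le> c) = (((1 / - \<beta>) *\<^sub>R p) \<bullet> x - c / - \<beta> \<le> r)" if "\<beta> < 0" for p \<beta> c
      using that by (simp add: field_simps)
    have "f x \<le> ereal r \<longleftrightarrow> (\<forall>((p, \<beta>), c)\<in>C. p \<bullet> x + \<beta> * r \<le> c)"
      unfolding epi by fastforce
    also have "\<dots> \<longleftrightarrow> (\<forall>((p, \<beta>), c)\<in>{((p, \<beta>), c) \<in> C. \<beta> < 0}. p \<bullet> x + \<beta> * r \<le> c)
       \<and> (\<forall>((p, \<beta>), c)\<in>{((p, \<beta>), c) \<in> C. \<beta> = 0}. p \<bullet> x + \<beta> * r \<le> c)"
      using slope by (fastforce simp: le_less)
    also have "\<dots> \<longleftrightarrow> (\<forall>(p, q)\<in>S. p \<bullet> x - q \<le> r) \<and> (\<forall>(p, q)\<in>T. p \<bullet> x \<le> q)"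
      unfolding S_def T_def using eq by fastforce
    finally show ?thesis .
  qed
  \<comment> \<open>Without affine pieces, membership in the epigraph would not depend on
    \<open>r\<close>, which forces the value -\<infinity> at \<open>x0\<close>.\<close>
  moreover have "S \<noteq> {}"
  proof
    assume "S = {}"
    then have "f x0 \<le> ereal r" for r
      using ST[of x0 r] ST[of x0 r0] r0 by auto
    then have "f x0 = -\<infinity>" by (metis ereal_bot)
    then show False using ninf by blast
  qed
  moreover have "finite S" "finite T" unfolding S_def T_def using C(1) by (auto intro: finite_subset)
  ultimately show ?thesis using that by blast
qed

lemma finite_maximizer:
  fixes h :: "'a \<Rightarrow> real"
  assumes "finite S" "S \<noteq> {}"
  obtains y where "y \<in> S" "\<forall>x\<in>S. h x \<le> h y"
proof -
  have "Max (h ` S) \<in> h ` S" using assms by (intro Max_in) auto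
  then obtain y where "y \<in> S" "Max (h ` S) = h y" by blast
  then show ?thesis using that assms(1) by (metis Max_ge finite_imageI imageI)
qed

text \<open>The sum of two finite maxima is the maximum of all pairwise sums of pieces, and the
  domain constraints are collected from both sides.\<close>

lemma polyhedrally_convex_add:
  fixes f g :: "'a::euclidean_space \<Rightarrow> ereal"
  assumes "polyhedrally_convex f" "polyhedrally_convex g"
    and f: "\<And>x. f x \<noteq> -\<infinity>" "f x0 < \<infinity>" and g: "\<And>x. g x \<noteq> -\<infinity>" "g x0 < \<infinity>"
  shows "polyhedrally_convex (\<lambda>x. f x + g x)"
proof -
  obtain S T where S: "finite S" "S \<noteq> {}" and "finite T" and
    fST: "\<And>x r. f x \<le> ereal r \<longleftrightarrow> (\<forall>(p, q)\<in>S. p \<bullet> x - q \<le> r) \<and> (\<forall>(p, q)\<in>T. p \<bullet> x \<le> q)"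
    using polyhedrally_convex_normal_form[of f x0] assms by metis
  obtain S' T' where S': "finite S'" "S' \<noteq> {}" and "finite T'" and
    gST: "\<And>x r. g x \<le> ereal r \<longleftrightarrow> (\<forall>(p, q)\<in>S'. p \<bullet> x - q \<le> r) \<and> (\<forall>(p, q)\<in>T'. p \<bullet> x \<le> q)"
    using polyhedrally_convex_normal_form[of g x0] assms by metis
  define C where "C = (\<lambda>((p, q), (p', q')). ((p + p', -1 :: real), q + q')) ` (S \<times> S')
    \<union> (\<lambda>(p, q). ((p, 0 :: real), q)) ` (T \<union> T')"
  have "f x + g x \<le> ereal r \<longleftrightarrow> (\<forall>(p, q)\<in>C. p \<bullet> (x, r) \<le> q)" for x :: 'a and r :: real
  proof -
    have C: "(\<forall>(p, q)\<in>C. p \<bullet> (x, r) \<le> q) \<longleftrightarrow>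
      (\<forall>(p, q)\<in>S. \<forall>(p', q')\<in>S'. (p \<bullet> x - q) + (p' \<bullet> x - q') \<le> r)
      \<and> (\<forall>(p, q)\<in>T. p \<bullet> x \<le> q) \<and> (\<forall>(p, q)\<in>T'. p \<bullet> x \<le> q)"
    proof -
      have eq: "(a + a' - r \<le> q + q') = ((a - q) + (a' - q') \<le> r)" for a a' q q' :: real
        by linarith
      show ?thesis
        unfolding C_def by (simp add: ball_Un case_prod_beta inner_add_left eq)
    qed
    show ?thesis unfolding C
    proof (intro iffI)
      assume le: "f x + g x \<le> ereal r"
      then obtain u v where uv: "f x = ereal u" "g x = ereal v"
        using f(1)[of x] g(1)[of x] by (cases "f x"; cases "g x") auto
      have "(p \<bullet> x - q) + (p' \<bullet> x - q') \<le> r" if "(p, q) \<in> S" "(p', q') \<in> S'" for p q p' q'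
      proof -
        have "p \<bullet> x - q \<le> u" using fST[of x u] uv that(1) by auto
        moreover have "p' \<bullet> x - q' \<le> v" using gST[of x v] uv that(2) by auto
        moreover have "u + v \<le> r" using le uv by simp
        ultimately show ?thesis by linarith
      qed
      moreover have "\<forall>(p, q)\<in>T. p \<bullet> x \<le> q" using fST[of x u] uv by simp
      moreover have "\<forall>(p, q)\<in>T'. p \<bullet> x \<le> q" using gST[of x v] uv by simp
      ultimately show "(\<forall>(p, q)\<in>S. \<forall>(p', q')\<in>S'. (p \<bullet> x - q) + (p' \<bullet> x - q') \<le> r)
        \<and> (\<forall>(p, q)\<in>T. p \<bullet> x \<le> q) \<and> (\<forall>(p, q)\<in>T'. p \<bullet> x \<le> q)"
        by blast
    next
      assume *: "(\<forall>(p, q)\<in>S. \<forall>(p', q')\<in>S'. (p \<bullet> x - q) + (p' \<bullet> x - q') \<le> r)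
        \<and> (\<forall>(p, q)\<in>T. p \<bullet> x \<le> q) \<and> (\<forall>(p, q)\<in>T'. p \<bullet> x \<le> q)"
      \<comment> \<open>The pieces active at \<open>x\<close> bound \<open>f x\<close> and
        \<open>g x\<close> from above, so the constraint for this single pair already bounds the
        sum.\<close>
      obtain p q where pq: "(p, q) \<in> S" "\<forall>(a, b)\<in>S. a \<bullet> x - b \<le> p \<bullet> x - q"
        by (rule finite_maximizer[OF S, of "\<lambda>(p, q). p \<bullet> x - q"]) (auto simp: case_prod_beta)
      obtain p' q' where pq': "(p', q') \<in> S'" "\<forall>(a, b)\<in>S'. a \<bullet> x - b \<le> p' \<bullet> x - q'"
        by (rule finite_maximizer[OF S', of "\<lambda>(p, q). p \<bullet> x - q"]) (auto simp: case_prod_beta)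
      have "f x + g x \<le> ereal (p \<bullet> x - q) + ereal (p' \<bullet> x - q')"
      proof (rule add_mono)
        show "f x \<le> ereal (p \<bullet> x - q)" unfolding fST using pq(2) * by blast
        show "g x \<le> ereal (p' \<bullet> x - q')" unfolding gST using pq'(2) * by blast
      qed
      also have "\<dots> \<le> ereal r" using * pq(1) pq'(1) by auto
      finally show "f x + g x \<le> ereal r" .
    qed
  qed
  moreover have "finite C"
    unfolding C_def using S(1) S'(1) \<open>finite T\<close> \<open>finite T'\<close> by blast
  ultimately show ?thesis
    unfolding polyhedrally_convex_def polyhedron_iff_system eepigraph_def
    by (intro exI[of _ C]) auto
qed

lemma polyhedrally_convex_zero: "polyhedrally_convex (\<lambda>x::'a::euclidean_space. 0)"
  unfolding polyhedrally_convex_def polyhedron_iff_system eepigraph_def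
  by (intro exI[of _ "{((0, -1), 0)}"]) (auto simp flip: zero_ereal_def)

text \<open>Exactness of \<open>(f + g)\<^sup>* = f\<^sup>* \<box> g\<^sup>*\<close>, phrased without conjugates.\<close>

definition minorants_split :: "('a::real_inner \<Rightarrow> ereal) \<Rightarrow> ('a \<Rightarrow> ereal) \<Rightarrow> bool" where
  "minorants_split f g \<longleftrightarrow>
     (\<forall>z \<alpha>. (\<forall>x. ereal (z \<bullet> x - \<alpha>) \<le> f x + g x) \<longrightarrow>
       (\<exists>u b. (\<forall>x. ereal (u \<bullet> x - b) \<le> f x) \<and> (\<forall>x. ereal ((z - u) \<bullet> x - (\<alpha> - b)) \<le> g x)))"

text \<open>This allows affine minorants to be tested on epigraph points only; for
  \<open>e = \<infinity>\<close> the right-hand side is vacuous.\<close>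

lemma ereal_le_iff_real_bounds:
  assumes "e \<noteq> -\<infinity>"
  shows "ereal c \<le> e \<longleftrightarrow> (\<forall>r. e \<le> ereal r \<longrightarrow> c \<le> r)"
  using assms by (cases e) auto

text \<open>Both epigraphs are lifted to triples \<open>(x, r, s)\<close>, with a separate height
  for each function. An affine minorant of the sum becomes the linear inequality
  \<open>z \<bullet> x - r - s \<le> \<alpha>\<close> on the intersection, to which
  \<open>polyhedron_Int_split\<close> applies.\<close>

lemma minorants_split_polyhedral:
  fixes f g :: "'a::euclidean_space \<Rightarrow> ereal"
  assumes "polyhedrally_convex f" "polyhedrally_convex g"
    and f: "\<And>x. f x \<noteq> -\<infinity>" "f x0 < \<infinity>" and g: "\<And>x. g x \<noteq> -\<infinity>" "g x0 < \<infinity>"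
  shows "minorants_split f g"
  unfolding minorants_split_def
proof (intro allI impI)
  fix z \<alpha> assume le: "\<forall>x. ereal (z \<bullet> x - \<alpha>) \<le> f x + g x"
  let ?P = "{(x, r, s). f x \<le> ereal r} :: ('a \<times> real \<times> real) set"
  let ?Q = "{(x, r, s). g x \<le> ereal s} :: ('a \<times> real \<times> real) set"
  obtain C where C: "finite C" "eepigraph f = {y. \<forall>(p, q)\<in>C. p \<bullet> y \<le> q}"
    using assms(1) unfolding polyhedrally_convex_def polyhedron_iff_system by blast
  obtain D where D: "finite D" "eepigraph g = {y. \<forall>(p, q)\<in>D. p \<bullet> y \<le> q}"
    using assms(2) unfolding polyhedrally_convex_def polyhedron_iff_system by blast
  have "f x \<le> ereal r \<longleftrightarrow> (\<forall>((p, \<beta>), q)\<in>C. p \<bullet> x + \<beta> * r \<le> q)" for x r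
    using C(2) unfolding eepigraph_def by force
  then have "polyhedron ?P"
    unfolding polyhedron_iff_system using C(1)
    by (intro exI[of _ "(\<lambda>((p, \<beta>), q). ((p, \<beta>, 0), q)) ` C"]) force
  moreover have "g x \<le> ereal r \<longleftrightarrow> (\<forall>((p, \<beta>), q)\<in>D. p \<bullet> x + \<beta> * r \<le> q)" for x r
    using D(2) unfolding eepigraph_def by force
  then have "polyhedron ?Q"
    unfolding polyhedron_iff_system using D(1)
    by (intro exI[of _ "(\<lambda>((p, \<beta>), q). ((p, 0, \<beta>), q)) ` D"]) force
  moreover
  obtain r0 s0 where r0: "f x0 = ereal r0" and s0: "g x0 = ereal s0"
    using f(1)[of x0] g(1)[of x0] f(2) g(2) by (cases "f x0"; cases "g x0") auto
  have mem: "(x0, r0, s) \<in> ?P" "(x0, r, s0) \<in> ?Q" for r s using r0 s0 by auto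
  then have "?P \<inter> ?Q \<noteq> {}" by blast
  moreover have "(z, -1, -1) \<bullet> y \<le> \<alpha>" if P: "y \<in> ?P" and Q: "y \<in> ?Q" for y
  proof -
    obtain x r s where y: "y = (x, r, s)" by (cases y)
    have "f x + g x \<le> ereal r + ereal s" using P Q y by (intro add_mono) auto
    then have "ereal (z \<bullet> x - \<alpha>) \<le> ereal (r + s)" using le order_trans by fastforce
    then show ?thesis using y by simp
  qed
  ultimately obtain p q where P: "\<And>y. y \<in> ?P \<Longrightarrow> p \<bullet> y \<le> q"
    and Q: "\<And>y. y \<in> ?Q \<Longrightarrow> ((z, -1, -1) - p) \<bullet> y \<le> \<alpha> - q"
    using polyhedron_Int_split[of ?P ?Q "(z, -1, -1)" \<alpha>] by blast
  obtain u \<rho> \<sigma> where p: "p = (u, \<rho>, \<sigma>)" by (cases p)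
  \<comment> \<open>\<open>?P\<close> leaves \<open>s\<close> free and \<open>?Q\<close> leaves
    \<open>r\<close> free, so an inequality valid on either set has coefficient zero there. This
    fixes \<sigma> = 0 and \<rho> = -1.\<close>
  have bounded_zero: "c = 0" if "\<And>t. c * t \<le> d" for c d :: real
  proof (rule ccontr)
    assume "c \<noteq> 0"
    then show False using that[of "(\<bar>d\<bar> + 1) / c"] by simp
  qed
  have "\<sigma> * t \<le> q - u \<bullet> x0 - \<rho> * r0" for t
    using P[OF mem(1)[of t]] p by simp
  then have \<sigma>: "\<sigma> = 0" by (rule bounded_zero)
  have "(-1 - \<rho>) * t \<le> \<alpha> - q - (z - u) \<bullet> x0 + s0" for t
    using Q[OF mem(2)[of t]] p \<sigma> by (simp add: algebra_simps)
  then have "-1 - \<rho> = 0" by (rule bounded_zero)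
  then have \<rho>: "\<rho> = -1" by simp
  have "ereal (u \<bullet> x - q) \<le> f x" for x
    unfolding ereal_le_iff_real_bounds[OF f(1)]
  proof (intro allI impI)
    fix r assume "f x \<le> ereal r"
    then show "u \<bullet> x - q \<le> r" using P[of "(x, r, 0)"] p \<sigma> \<rho> by simp
  qed
  moreover have "ereal ((z - u) \<bullet> x - (\<alpha> - q)) \<le> g x" for x
    unfolding ereal_le_iff_real_bounds[OF g(1)]
  proof (intro allI impI)
    fix r assume "g x \<le> ereal r"
    then show "(z - u) \<bullet> x - (\<alpha> - q) \<le> r" using Q[of "(x, 0, r)"] p \<sigma> \<rho> by simp
  qed
  ultimately show "\<exists>u b. (\<forall>x. ereal (u \<bullet> x - b) \<le> f x) \<and> (\<forall>x. ereal ((z - u) \<bullet> x - (\<alpha> - b)) \<le> g x)"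
    by blast
qed

section \<open>Splitting affine minorants under an interiority condition\<close>

lemma convex_eepigraph_if_econvex:
  assumes "econvex f"
  shows "convex (eepigraph f)"
  unfolding convex_alt
proof (clarify)
  fix x r y s and t :: real
  assume xr: "(x, r) \<in> eepigraph f" and ys: "(y, s) \<in> eepigraph f" and t: "0 \<le> t" "t \<le> 1"
  show "(1 - t) *\<^sub>R (x, r) + t *\<^sub>R (y, s) \<in> eepigraph f"
  proof (cases "t = 0 \<or> t = 1")
    case True
    then show ?thesis using xr ys by auto
  next
    case False
    then have t': "0 < t" "t < 1" using t by auto
    then have "f ((1 - t) *\<^sub>R x + t *\<^sub>R y) \<le> ereal (1 - t) * f x + ereal t * f y"
      using assms unfolding econvex_def by blast
    also have "\<dots> \<le> ereal (1 - t) * ereal r + ereal t * ereal s"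
      using xr ys t' unfolding eepigraph_def by (intro add_mono ereal_mult_left_mono) auto
    finally show ?thesis unfolding eepigraph_def by simp
  qed
qed

lemma convex_eepigraph_add:
  fixes f g :: "'a::real_vector \<Rightarrow> ereal"
  assumes f: "convex (eepigraph f)" "\<And>x. f x \<noteq> -\<infinity>" and g: "convex (eepigraph g)" "\<And>x. g x \<noteq> -\<infinity>"
  shows "convex (eepigraph (\<lambda>x. f x + g x))"
proof (rule convexI)
  fix p q and u v :: real
  assume p: "p \<in> eepigraph (\<lambda>x. f x + g x)" and q: "q \<in> eepigraph (\<lambda>x. f x + g x)"
    and uv: "0 \<le> u" "0 \<le> v" "u + v = 1"
  obtain x r y s where pq: "p = (x, r)" "q = (y, s)" by (cases p; cases q)
  have le: "f x + g x \<le> ereal r" "f y + g y \<le> ereal s"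
    using p q pq unfolding eepigraph_def by auto
  obtain a b where ab: "f x = ereal a" "g x = ereal b"
    using le(1) f(2)[of x] g(2)[of x] by (cases "f x"; cases "g x") auto
  obtain c d where cd: "f y = ereal c" "g y = ereal d"
    using le(2) f(2)[of y] g(2)[of y] by (cases "f y"; cases "g y") auto
  have "u *\<^sub>R (x, a) + v *\<^sub>R (y, c) \<in> eepigraph f"
    using ab cd uv by (intro convexD[OF f(1)]) (auto simp: eepigraph_def)
  moreover have "u *\<^sub>R (x, b) + v *\<^sub>R (y, d) \<in> eepigraph g"
    using ab cd uv by (intro convexD[OF g(1)]) (auto simp: eepigraph_def)
  ultimately have "f (u *\<^sub>R x + v *\<^sub>R y) + g (u *\<^sub>R x + v *\<^sub>R y)
      \<le> ereal (u * a + v * c) + ereal (u * b + v * d)"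
    unfolding eepigraph_def by (intro add_mono) auto
  also have "\<dots> = ereal (u * (a + b) + v * (c + d))" by (simp add: algebra_simps)
  also have "\<dots> \<le> ereal (u * r + v * s)"
    using le ab cd uv by (auto intro!: add_mono mult_left_mono)
  finally show "u *\<^sub>R p + v *\<^sub>R q \<in> eepigraph (\<lambda>x. f x + g x)"
    using pq unfolding eepigraph_def by simp
qed

lemma minorants_split_interior:
  fixes f g :: "'a::euclidean_space \<Rightarrow> ereal"
  assumes f: "convex (eepigraph f)" "\<And>x. f x \<noteq> -\<infinity>" "f x0 < \<infinity>"
    and g: "convex (eepigraph g)" "\<And>x. g x \<noteq> -\<infinity>" "x0 \<in> interior (edom g)"
  shows "minorants_split f g"
  unfolding minorants_split_def
proof (intro allI impI)
  fix z \<alpha> assume le: "\<forall>x. ereal (z \<bullet> x - \<alpha>) \<le> f x + g x"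
  let ?A = "eepigraph f"
  \<comment> \<open>Writing \<open>s < z \<bullet> x - \<alpha> - g x\<close> with
    \<open>g x\<close> alone on one side excludes points where \<open>g\<close> is infinite. The
    strict inequality makes the set disjoint from \<open>?A\<close>.\<close>
  let ?B = "{(x, s). g x < ereal (z \<bullet> x - \<alpha> - s)}"
  obtain e where e: "e > 0" "\<And>x. dist x x0 < e \<Longrightarrow> g x < \<infinity>"
    using g(3) unfolding mem_interior edom_def by (auto simp: subset_iff dist_commute)
  obtain r0 where r0: "f x0 = ereal r0" using f(2)[of x0] f(3) by (cases "f x0") auto
  have g_real: "\<exists>v. g x = ereal v" if "g x < \<infinity>" for x
    using that g(2)[of x] by (cases "g x") auto
  have "convex ?B"
  proof (rule convexI)
    fix p q and u v :: real
    assume p: "p \<in> ?B" and q: "q \<in> ?B" and uv: "0 \<le> u" "0 \<le> v" "u + v = 1"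
    obtain x r y s where pq: "p = (x, r)" "q = (y, s)" by (cases p; cases q)
    obtain a b where ab: "g x = ereal a" "g y = ereal b"
      using p q pq g_real[of x] g_real[of y] by fastforce
    have a: "a < z \<bullet> x - \<alpha> - r" and b: "b < z \<bullet> y - \<alpha> - s" using p q pq ab by auto
    have "u *\<^sub>R (x, a) + v *\<^sub>R (y, b) \<in> eepigraph g"
      using ab uv by (intro convexD[OF g(1)]) (auto simp: eepigraph_def)
    then have "g (u *\<^sub>R x + v *\<^sub>R y) \<le> ereal (u * a + v * b)" unfolding eepigraph_def by simp
    also have "u * a + v * b < u * (z \<bullet> x - \<alpha> - r) + v * (z \<bullet> y - \<alpha> - s)"
    \<comment> \<open>Strictness survives only in a summand of nonzero weight, and one of the two
      weights may vanish.\<close>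
    proof (cases "u = 0")
      case True
      then show ?thesis using uv b by simp
    next
      case False
      then show ?thesis using uv a b by (intro add_less_le_mono) (auto intro: mult_left_mono)
    qed
    also have "\<dots> = z \<bullet> (u *\<^sub>R x + v *\<^sub>R y) - (u + v) * \<alpha> - (u * r + v * s)"
      by (simp add: algebra_simps inner_add_right)
    finally show "u *\<^sub>R p + v *\<^sub>R q \<in> ?B" using pq uv by simp
  qed
  moreover have "?A \<noteq> {}" using r0 by (auto simp: eepigraph_def intro!: exI[of _ x0] exI[of _ r0])
  moreover have "?B \<noteq> {}"
  proof -
    obtain v where "g x0 = ereal v" using g_real[of x0] e by auto
    then have "(x0, z \<bullet> x0 - \<alpha> - v - 1) \<in> ?B" by simp
    then show ?thesis by blast
  qed
  moreover have "?A \<inter> ?B = {}"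
  proof -
    have False if A: "(x, s) \<in> ?A" and "(x, s) \<in> ?B" for x s
    proof -
      have g': "g x < ereal (z \<bullet> x - \<alpha> - s)" using that by simp
      then obtain v where v: "g x = ereal v" using g_real[of x] by fastforce
      have "ereal (z \<bullet> x - \<alpha>) \<le> ereal s + ereal v"
        using le A v add_right_mono[of "f x" "ereal s" "g x"] unfolding eepigraph_def
        by (metis (mono_tags, lifting) case_prodD mem_Collect_eq order_trans)
      then show False using g' v by simp
    qed
    then show ?thesis by auto
  qed
  ultimately obtain n b where n: "n \<noteq> 0" "\<forall>y\<in>?A. n \<bullet> y \<le> b" "\<forall>y\<in>?B. n \<bullet> y \<ge> b"
    using separating_hyperplane_sets[OF f(1), of ?B] by blast
  obtain u \<beta> where u: "n = (u, \<beta>)" by (cases n)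
  have nA: "u \<bullet> x + \<beta> * r \<le> b" if "f x \<le> ereal r" for x r
    using n(2) that u unfolding eepigraph_def by auto
  have nB: "u \<bullet> x + \<beta> * s \<ge> b" if "g x = ereal v" "s < z \<bullet> x - \<alpha> - v" for x s v
    using n(3) that u by auto
  have "\<beta> \<le> 0"
  proof (rule ccontr)
    assume \<beta>: "\<not> \<beta> \<le> 0"
    let ?t = "(\<bar>b - u \<bullet> x0 - \<beta> * r0\<bar> + 1) / \<beta>"
    have "?t \<ge> 0" using \<beta> by (intro divide_nonneg_pos) auto
    then have "u \<bullet> x0 + \<beta> * (r0 + ?t) \<le> b" using r0 by (intro nA) auto
    moreover have "\<beta> * ?t = \<bar>b - u \<bullet> x0 - \<beta> * r0\<bar> + 1" using \<beta> by simp
    ultimately show False unfolding distrib_left by linarith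
  qed
  \<comment> \<open>For a vertical hyperplane, a step of length \<open>e / 2\<close> from
    \<open>x0\<close> against \<open>u\<close> stays in the domain of \<open>g\<close>, so
    separation gives \<open>u \<bullet> x \<ge> b\<close>, although
    \<open>u \<bullet> x0 \<le> b\<close> and the step strictly decreases \<open>u\<close>.\<close>
  moreover have "\<beta> \<noteq> 0"
  proof
    assume \<beta>: "\<beta> = 0"
    then have "u \<noteq> 0" using n(1) u by (auto simp: zero_prod_def)
    define x where "x = x0 - (e / 2 / norm u) *\<^sub>R u"
    have "dist x x0 < e" using e(1) \<open>u \<noteq> 0\<close> by (simp add: x_def dist_norm)
    then obtain v where v: "g x = ereal v" using g_real e(2) by blast
    have "u \<bullet> x \<ge> b" using nB[OF v, of "z \<bullet> x - \<alpha> - v - 1"] \<beta> by simp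
    moreover have "u \<bullet> x0 \<le> b" using nA[of x0 r0] r0 \<beta> by simp
    moreover have "u \<bullet> x = u \<bullet> x0 - e / 2 * norm u"
      using \<open>u \<noteq> 0\<close> by (simp add: x_def inner_diff_right dot_square_norm power2_eq_square)
    moreover have "e / 2 * norm u > 0" using e(1) \<open>u \<noteq> 0\<close> by simp
    ultimately show False by linarith
  qed
  ultimately have \<beta>: "\<beta> < 0" by simp
  \<comment> \<open>Scaling the height coefficient to -1 turns the separating hyperplane into the
    graph of an affine function between the two sets.\<close>
  define w c where "w = (1 / - \<beta>) *\<^sub>R u" and "c = b / - \<beta>"
  have w: "w \<bullet> x = (u \<bullet> x) / - \<beta>" for x by (simp add: w_def)
  have "ereal (w \<bullet> x - c) \<le> f x" for x
    unfolding ereal_le_iff_real_bounds[OF f(2)]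
  proof (intro allI impI)
    fix r assume "f x \<le> ereal r"
    from nA[OF this] show "w \<bullet> x - c \<le> r"
      using \<beta> by (simp add: w c_def field_simps)
  qed
  moreover have "ereal ((z - w) \<bullet> x - (\<alpha> - c)) \<le> g x" for x
  proof (cases "g x")
    case (real v)
    \<comment> \<open>Separation concerns only heights strictly below the hypograph boundary;
      density of the reals gives the bound at the boundary itself.\<close>
    have "z \<bullet> x - \<alpha> - v \<le> w \<bullet> x - c"
    proof (rule dense_le)
      fix s assume "s < z \<bullet> x - \<alpha> - v"
      from nB[OF real this] show "s \<le> w \<bullet> x - c"
        using \<beta> by (simp add: w c_def field_simps)
    qed
    then show ?thesis using real by (simp add: inner_diff_left)
  qed (use g(2) in auto)
  ultimately show "\<exists>u b. (\<forall>x. ereal (u \<bullet> x - b) \<le> f x) \<and> (\<forall>x. ereal ((z - u) \<bullet> x - (\<alpha> - b)) \<le> g x)"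
    by blast
qed

text \<open>The last summand is split off and the induction hypothesis handles the minorant of the
  rest. The constants satisfy only an inequality because the empty sum already yields no more than
  \<open>0 \<le> \<alpha>\<close>.\<close>

lemma affine_minorant_sum:
  fixes f :: "nat \<Rightarrow> 'a::real_inner \<Rightarrow> ereal"
  assumes "\<And>n. n < m \<Longrightarrow> minorants_split (\<lambda>x. \<Sum>i\<in>{1..n}. f i x) (f (Suc n))"
    and "\<And>x. ereal (z \<bullet> x - \<alpha>) \<le> (\<Sum>i\<in>{1..m}. f i x)"
  shows "\<exists>w c. (\<forall>i\<in>{1..m}. \<forall>x. ereal (w i \<bullet> x - c i) \<le> f i x)
    \<and> (\<Sum>i\<in>{1..m}. w i) = z \<and> (\<Sum>i\<in>{1..m}. c i) \<le> (\<alpha> :: real)"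
  using assms
proof (induction m arbitrary: z \<alpha>)
  case 0
  then have le: "z \<bullet> x \<le> \<alpha>" for x by (simp flip: zero_ereal_def)
  have "z = 0"
  proof (rule ccontr)
    assume "z \<noteq> 0"
    \<comment> \<open>At this multiple of \<open>z\<close> the linear form takes the value
      \<open>\<bar>\<alpha>\<bar> + 1\<close>.\<close>
    then show False using le[of "((\<bar>\<alpha>\<bar> + 1) / (z \<bullet> z)) *\<^sub>R z"] by simp
  qed
  then show ?case using le[of 0] by simp
next
  case (Suc m)
  have "minorants_split (\<lambda>x. \<Sum>i\<in>{1..m}. f i x) (f (Suc m))" using Suc.prems(1) by simp
  moreover have "\<forall>x. ereal (z \<bullet> x - \<alpha>) \<le> (\<Sum>i\<in>{1..m}. f i x) + f (Suc m) x"
    using Suc.prems(2) by simp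
  ultimately obtain u b where u: "\<And>x. ereal (u \<bullet> x - b) \<le> (\<Sum>i\<in>{1..m}. f i x)"
    and last: "\<And>x. ereal ((z - u) \<bullet> x - (\<alpha> - b)) \<le> f (Suc m) x"
    unfolding minorants_split_def by blast
  have "\<exists>w c. (\<forall>i\<in>{1..m}. \<forall>x. ereal (w i \<bullet> x - c i) \<le> f i x)
    \<and> (\<Sum>i\<in>{1..m}. w i) = u \<and> (\<Sum>i\<in>{1..m}. c i) \<le> b"
    using u Suc.prems(1) by (intro Suc.IH) auto
  then obtain w c where w: "\<forall>i\<in>{1..m}. \<forall>x. ereal (w i \<bullet> x - c i) \<le> f i x"
    "(\<Sum>i\<in>{1..m}. w i) = u" "(\<Sum>i\<in>{1..m}. c i) \<le> b" by blast
  have "(\<Sum>i\<in>{1..m}. (w(Suc m := z - u)) i) = u" "(\<Sum>i\<in>{1..m}. (c(Suc m := \<alpha> - b)) i) \<le> b"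
    using w(2,3) by auto
  then show ?case
    using w(1) last
    by (intro exI[of _ "w(Suc m := z - u)"] exI[of _ "c(Suc m := \<alpha> - b)"])
      (auto simp: le_Suc_eq)
qed

section \<open>Conjugates and subdifferentials of sums\<close>

text \<open>The Riesz representation carries the splitting results, proved with inner products, over
  to the dual space.\<close>

lemma blinfun_eq_inner_right:
  fixes z :: "'a::euclidean_space \<Rightarrow>\<^sub>L real"
  obtains v where "z = blinfun_inner_right v"
proof
  show "z = blinfun_inner_right (\<Sum>b\<in>Basis. blinfun_apply z b *\<^sub>R b)"
    by (rule blinfun_euclidean_eqI) (simp add: inner_sum_left inner_Basis if_distrib sum.delta cong: if_cong)
qed

lemma fenchel_conjugate_le_iff:
  assumes "\<And>x. f x \<noteq> -\<infinity>"
  shows "fenchel_conjugate f z \<le> ereal c \<longleftrightarrow> (\<forall>x. ereal (blinfun_apply z x - c) \<le> f x)"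
proof -
  have "ereal (blinfun_apply z x) - f x \<le> ereal c \<longleftrightarrow> ereal (blinfun_apply z x - c) \<le> f x" for x
    using assms[of x] by (cases "f x") auto
  then show ?thesis unfolding fenchel_conjugate_def by (simp add: SUP_le_iff)
qed

lemma sum_ereal_cases:
  fixes g :: "'i \<Rightarrow> ereal"
  assumes "finite I" "\<And>i. i \<in> I \<Longrightarrow> g i \<noteq> -\<infinity>"
  obtains "sum g I = \<infinity>"
  | h where "\<And>i. i \<in> I \<Longrightarrow> g i = ereal (h i)" "sum g I = ereal (sum h I)"
proof (cases "\<exists>i\<in>I. g i = \<infinity>")
  case True
  then show ?thesis using that(1) assms(1) by (simp add: sum_Pinfty)
next
  case False
  then have "\<forall>i\<in>I. g i = ereal (real_of_ereal (g i))"
    using assms(2) by (auto simp: ereal_real)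
  then show ?thesis
    using that(2)[of "\<lambda>i. real_of_ereal (g i)"] by (metis (no_types, lifting) sum.cong sum_ereal)
qed

text \<open>In the conjugate of the sum all summands are evaluated at one common \<open>x\<close>,
  whereas on the right each supremum is taken independently.\<close>

lemma fenchel_conjugate_sum_le:
  fixes f :: "'i \<Rightarrow> 'a::real_normed_vector \<Rightarrow> ereal"
  assumes "finite I" "\<And>i x. i \<in> I \<Longrightarrow> f i x \<noteq> -\<infinity>"
  shows "fenchel_conjugate (\<lambda>x. \<Sum>i\<in>I. f i x) (\<Sum>i\<in>I. w i) \<le> (\<Sum>i\<in>I. fenchel_conjugate (f i) (w i))"
  unfolding fenchel_conjugate_def[of "\<lambda>x. \<Sum>i\<in>I. f i x"]
proof (rule SUP_least)
  fix x
  have "ereal (blinfun_apply (\<Sum>i\<in>I. w i) x) - (\<Sum>i\<in>I. f i x)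
      \<le> (\<Sum>i\<in>I. ereal (blinfun_apply (w i) x) - f i x)"
  proof (rule sum_ereal_cases[of I "\<lambda>i. f i x"])
    fix h assume h: "\<And>i. i \<in> I \<Longrightarrow> f i x = ereal (h i)" "(\<Sum>i\<in>I. f i x) = ereal (sum h I)"
    have "(\<Sum>i\<in>I. ereal (blinfun_apply (w i) x) - f i x) = ereal (\<Sum>i\<in>I. blinfun_apply (w i) x - h i)"
      using h(1) by (simp flip: sum_ereal)
    then show ?thesis using h(2) by (simp add: blinfun.sum_left sum_subtractf)
  qed (use assms in auto)
  also have "\<dots> \<le> (\<Sum>i\<in>I. fenchel_conjugate (f i) (w i))"
    unfolding fenchel_conjugate_def by (intro sum_mono SUP_upper) auto
  finally show "ereal (blinfun_apply (\<Sum>i\<in>I. w i) x) - (\<Sum>i\<in>I. f i x)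
    \<le> (\<Sum>i\<in>I. fenchel_conjugate (f i) (w i))" .
qed

text \<open>This is the analogue of \<open>minorants_split\<close> for a family, stated with
  functionals. Both conclusions of the theorem are derived from it.\<close>

definition affine_minorants_decompose :: "'i set \<Rightarrow> ('i \<Rightarrow> 'a::real_normed_vector \<Rightarrow> ereal) \<Rightarrow> bool" where
  "affine_minorants_decompose I f \<longleftrightarrow>
    (\<forall>z \<alpha>. (\<forall>x. ereal (blinfun_apply z x - \<alpha>) \<le> (\<Sum>i\<in>I. f i x)) \<longrightarrow>
      (\<exists>w c. (\<forall>i\<in>I. \<forall>x. ereal (blinfun_apply (w i) x - c i) \<le> f i x)
        \<and> (\<Sum>i\<in>I. w i) = z \<and> (\<Sum>i\<in>I. c i) \<le> \<alpha>))"

text \<open>A real value \<alpha> of the conjugate at \<open>z\<close> says that \<open>z\<close>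
  with offset \<alpha> is an affine minorant of the sum. Its decomposition yields functionals whose
  conjugate values add up to at most \<alpha>, and the opposite inequality is elementary.\<close>

lemma fenchel_conjugate_sum:
  fixes f :: "'i \<Rightarrow> 'a::real_normed_vector \<Rightarrow> ereal"
  assumes dec: "affine_minorants_decompose I f"
    and I: "finite I" "I \<noteq> {}"
    and ninf: "\<And>i x. i \<in> I \<Longrightarrow> f i x \<noteq> -\<infinity>"
    and x0: "\<And>i. i \<in> I \<Longrightarrow> f i x0 < \<infinity>"
  shows "fenchel_conjugate (\<lambda>x. \<Sum>i\<in>I. f i x) z = inf_convolution I (\<lambda>i. fenchel_conjugate (f i)) z"
    and "inf_convolution_exact_at I (\<lambda>i. fenchel_conjugate (f i)) z"
proof -
  let ?F = "\<lambda>x. \<Sum>i\<in>I. f i x"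
  have F: "?F x \<noteq> -\<infinity>" for x
    by (rule sum_ereal_cases[of I "\<lambda>i. f i x"]) (use I ninf in auto)
  have x0': "?F x0 \<noteq> \<infinity>"
    using x0 I by (auto simp: sum_Pinfty)
  have le: "fenchel_conjugate ?F z \<le> inf_convolution I (\<lambda>i. fenchel_conjugate (f i)) z"
    unfolding inf_convolution_def
    by (rule Inf_greatest) (use fenchel_conjugate_sum_le[of I f] I ninf in auto)
  have "\<exists>w. (\<Sum>i\<in>I. w i) = z \<and> (\<Sum>i\<in>I. fenchel_conjugate (f i) (w i)) \<le> fenchel_conjugate ?F z"
  proof (cases "fenchel_conjugate ?F z")
    case (real \<alpha>)
    then have "\<forall>x. ereal (blinfun_apply z x - \<alpha>) \<le> ?F x"
      using fenchel_conjugate_le_iff[of ?F z \<alpha>] F by simp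
    then obtain w c where w: "\<forall>i\<in>I. \<forall>x. ereal (blinfun_apply (w i) x - c i) \<le> f i x"
      "(\<Sum>i\<in>I. w i) = z" "(\<Sum>i\<in>I. c i) \<le> \<alpha>"
      using dec unfolding affine_minorants_decompose_def by blast
    have "(\<Sum>i\<in>I. fenchel_conjugate (f i) (w i)) \<le> (\<Sum>i\<in>I. ereal (c i))"
      using w(1) ninf by (intro sum_mono) (simp add: fenchel_conjugate_le_iff)
    also have "\<dots> \<le> ereal \<alpha>" using w(3) by simp
    finally show ?thesis using w(2) real by auto
  next
    \<comment> \<open>Every decomposition of \<open>z\<close> attains \<infinity>; putting all of
      \<open>z\<close> at one index provides one.\<close>
    case PInf
    obtain j where "j \<in> I" using I by blast
    then show ?thesis
      using PInf I by (intro exI[of _ "\<lambda>i. if i = j then z else 0"]) simp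
  next
    \<comment> \<open>This value would force the sum to be \<infinity> at \<open>x0\<close>.\<close>
    case MInf
    have "ereal (blinfun_apply z x0) - ?F x0 \<le> -\<infinity>"
      unfolding MInf[symmetric] fenchel_conjugate_def by (rule SUP_upper) simp
    then show ?thesis using x0' by (cases "?F x0") auto
  qed
  then obtain w where w: "(\<Sum>i\<in>I. w i) = z"
    "(\<Sum>i\<in>I. fenchel_conjugate (f i) (w i)) \<le> fenchel_conjugate ?F z" by blast
  have "inf_convolution I (\<lambda>i. fenchel_conjugate (f i)) z \<le> (\<Sum>i\<in>I. fenchel_conjugate (f i) (w i))"
    unfolding inf_convolution_def using w(1) by (intro Inf_lower) auto
  then show "fenchel_conjugate ?F z = inf_convolution I (\<lambda>i. fenchel_conjugate (f i)) z"
    and "inf_convolution_exact_at I (\<lambda>i. fenchel_conjugate (f i)) z"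
    using w le unfolding inf_convolution_exact_at_def by (auto intro!: exI[of _ w] antisym)
qed

text \<open>A subgradient at \<open>x\<close> is the slope of an affine minorant touching the
  function at \<open>x\<close>. If the minorant of the sum touches, so does each part of its
  decomposition. Where the sum is infinite, some summand has an empty subdifferential, which empties
  the Minkowski sum.\<close>

lemma subdifferential_sum:
  fixes f :: "'i \<Rightarrow> 'a::real_normed_vector \<Rightarrow> ereal"
  assumes dec: "affine_minorants_decompose I f"
    and I: "finite I"
    and ninf: "\<And>i x. i \<in> I \<Longrightarrow> f i x \<noteq> -\<infinity>"
  shows "subdifferential (\<lambda>y. \<Sum>i\<in>I. f i y) x = (\<Sum>i\<in>I. subdifferential (f i) x)"
proof (rule sum_ereal_cases[of I "\<lambda>i. f i x"])
  assume inf: "(\<Sum>i\<in>I. f i x) = \<infinity>"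
  then obtain i where "i \<in> I" "f i x = \<infinity>" by (auto simp: sum_Pinfty)
  then have "subdifferential (f i) x = {}" unfolding subdifferential_def by simp
  then show ?thesis
    using inf \<open>i \<in> I\<close> unfolding set_sum_alt[OF I] by (force simp: subdifferential_def[of "\<lambda>y. \<Sum>i\<in>I. f i y"])
next
  fix h assume h: "\<And>i. i \<in> I \<Longrightarrow> f i x = ereal (h i)" "(\<Sum>i\<in>I. f i x) = ereal (sum h I)"
  have sub_i: "w \<in> subdifferential (f i) x \<longleftrightarrow> (\<forall>y. ereal (blinfun_apply w (y - x) + h i) \<le> f i y)"
    if "i \<in> I" for w i
    using h(1)[OF that] unfolding subdifferential_def by simp
  have sub: "z \<in> subdifferential (\<lambda>y. \<Sum>i\<in>I. f i y) x
      \<longleftrightarrow> (\<forall>y. ereal (blinfun_apply z (y - x) + sum h I) \<le> (\<Sum>i\<in>I. f i y))" for z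
    using h(2) unfolding subdifferential_def by simp
  show ?thesis
  proof (intro set_eqI iffI)
    fix z assume "z \<in> subdifferential (\<lambda>y. \<Sum>i\<in>I. f i y) x"
    then have "\<forall>y. ereal (blinfun_apply z y - (blinfun_apply z x - sum h I)) \<le> (\<Sum>i\<in>I. f i y)"
      unfolding sub by (simp add: blinfun.diff_right algebra_simps)
    then obtain w c where w: "\<And>i y. i \<in> I \<Longrightarrow> ereal (blinfun_apply (w i) y - c i) \<le> f i y"
      "(\<Sum>i\<in>I. w i) = z" "(\<Sum>i\<in>I. c i) \<le> blinfun_apply z x - sum h I"
      using dec unfolding affine_minorants_decompose_def by blast
    \<comment> \<open>\<open>d i\<close> is the gap at \<open>x\<close> between \<open>f i\<close>
      and its affine minorant. The gaps are nonnegative with sum at most zero, so they all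
      vanish.\<close>
    define d where "d i = h i - (blinfun_apply (w i) x - c i)" for i
    have d_nonneg: "d i \<ge> 0" if "i \<in> I" for i
      using w(1)[OF that, of x] h(1)[OF that] by (simp add: d_def)
    have "sum d I \<le> 0"
      using w(3) by (simp add: d_def sum_subtractf blinfun.sum_left flip: w(2))
    then have "sum d I = 0" using d_nonneg by (intro antisym sum_nonneg)
    then have c: "c i = blinfun_apply (w i) x - h i" if "i \<in> I" for i
      using d_nonneg that I sum_nonneg_eq_0_iff[of I d] by (auto simp: d_def)
    have "w i \<in> subdifferential (f i) x" if "i \<in> I" for i
      unfolding sub_i[OF that] using w(1)[OF that] c[OF that]
      by (simp add: blinfun.diff_right algebra_simps)
    then show "z \<in> (\<Sum>i\<in>I. subdifferential (f i) x)"
      using w(2) unfolding set_sum_alt[OF I] by blast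
  next
    fix z assume "z \<in> (\<Sum>i\<in>I. subdifferential (f i) x)"
    then obtain w where w: "z = sum w I" "\<And>i. i \<in> I \<Longrightarrow> w i \<in> subdifferential (f i) x"
      unfolding set_sum_alt[OF I] by blast
    show "z \<in> subdifferential (\<lambda>y. \<Sum>i\<in>I. f i y) x"
      unfolding sub
    proof
      fix y
      have "ereal (blinfun_apply z (y - x) + sum h I) = (\<Sum>i\<in>I. ereal (blinfun_apply (w i) (y - x) + h i))"
        using w(1) by (simp add: blinfun.sum_left sum.distrib)
      also have "\<dots> \<le> (\<Sum>i\<in>I. f i y)" using w(2) sub_i by (intro sum_mono) blast
      finally show "ereal (blinfun_apply z (y - x) + sum h I) \<le> (\<Sum>i\<in>I. f i y)" .
    qed
  qed
qed (use I ninf in auto)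

lemma affine_minorants_decompose_polyhedral_continuous:
  fixes f :: "nat \<Rightarrow> 'a::euclidean_space \<Rightarrow> ereal"
  assumes ninf: "\<And>i x. i \<in> {1..m} \<Longrightarrow> f i x \<noteq> -\<infinity>"
    and poly: "\<And>i. i \<in> {1..k} \<Longrightarrow> polyhedrally_convex (f i)"
    and conv: "\<And>i. i \<in> {k+1..m} \<Longrightarrow> econvex (f i)"
    and x0: "\<And>i. i \<in> {1..m} \<Longrightarrow> f i x0 < \<infinity>"
    and cont: "\<And>i. i \<in> {k+1..m} \<Longrightarrow> isCont (f i) x0"
  shows "affine_minorants_decompose {1..m} f"
proof -
  let ?F = "\<lambda>n x. \<Sum>i\<in>{1..n}. f i x"
  have F_ninf: "?F n x \<noteq> -\<infinity>" if "n \<le> m" for n x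
    by (rule sum_ereal_cases[of "{1..n}" "\<lambda>i. f i x"]) (use that ninf in auto)
  have F_x0: "?F n x0 < \<infinity>" if "n \<le> m" for n
    using that x0 by (simp add: less_top sum_Pinfty top_ereal_def)
  have F_poly: "polyhedrally_convex (?F n)" if "n \<le> k" "n \<le> m" for n
    using that
  proof (induction n)
    case 0
    then show ?case by (simp add: polyhedrally_convex_zero)
  next
    case (Suc n)
    then have "polyhedrally_convex (\<lambda>x. ?F n x + f (Suc n) x)"
      using F_ninf F_x0 ninf x0 poly by (intro polyhedrally_convex_add[of _ _ x0]) auto
    then show ?case by simp
  qed
  have f_convex: "convex (eepigraph (f i))" if "i \<in> {1..m}" for i
    using that poly[of i] conv[of i] convex_eepigraph_if_econvex
    by (cases "i \<le> k") (auto simp: polyhedrally_convex_def polyhedron_imp_convex)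
  have F_convex: "convex (eepigraph (?F n))" if "n \<le> m" for n
    using that
  proof (induction n)
    case 0
    then show ?case
      using polyhedrally_convex_zero polyhedron_imp_convex unfolding polyhedrally_convex_def by auto
  next
    case (Suc n)
    then have "convex (eepigraph (\<lambda>x. ?F n x + f (Suc n) x))"
      using F_ninf ninf f_convex by (intro convex_eepigraph_add) auto
    then show ?case by simp
  qed
  have split: "minorants_split (?F n) (f (Suc n))" if "n < m" for n
  proof (cases "Suc n \<le> k")
    case True
    then show ?thesis
      using that F_ninf F_x0 F_poly ninf x0 poly by (intro minorants_split_polyhedral[of _ _ x0]) auto
  next
    case False
    then have "isCont (f (Suc n)) x0" using that cont by simp
    moreover have "f (Suc n) x0 < \<infinity>" using that x0 by simp
    \<comment> \<open>Continuity at \<open>x0\<close> keeps the value below \<infinity> on a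
      neighbourhood, which makes \<open>x0\<close> interior to the domain.\<close>
    ultimately have "\<forall>\<^sub>F x in nhds x0. f (Suc n) x < \<infinity>"
      unfolding isCont_def eventually_nhds_conv_at by (blast intro: order_tendstoD(2))
    then have "x0 \<in> interior (edom (f (Suc n)))"
      unfolding eventually_nhds edom_def interior_def by blast
    then show ?thesis
      using that F_ninf F_x0 F_convex f_convex ninf by (intro minorants_split_interior[of _ x0]) auto
  qed
  show ?thesis
    unfolding affine_minorants_decompose_def
  proof (intro allI impI)
    fix z :: "'a \<Rightarrow>\<^sub>L real" and \<alpha>
    assume le: "\<forall>x. ereal (blinfun_apply z x - \<alpha>) \<le> ?F m x"
    obtain v where v: "z = blinfun_inner_right v" by (rule blinfun_eq_inner_right)
    then obtain w c where w: "\<forall>i\<in>{1..m}. \<forall>x. ereal (w i \<bullet> x - c i) \<le> f i x"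
      "(\<Sum>i\<in>{1..m}. w i) = v" "(\<Sum>i\<in>{1..m}. c i) \<le> \<alpha>"
      using affine_minorant_sum[of m f v \<alpha>] split le by auto
    have "(\<Sum>i\<in>{1..m}. blinfun_inner_right (w i)) = z"
      unfolding v by (rule blinfun_eqI) (simp add: blinfun.sum_left flip: w(2) inner_sum_left)
    then show "\<exists>w c. (\<forall>i\<in>{1..m}. \<forall>x. ereal (blinfun_apply (w i) x - c i) \<le> f i x)
        \<and> (\<Sum>i\<in>{1..m}. w i) = z \<and> (\<Sum>i\<in>{1..m}. c i) \<le> \<alpha>"
      using w(1,3) by (intro exI[of _ "\<lambda>i. blinfun_inner_right (w i)"] exI[of _ c]) simp
  qed
qed

theorem corollary4p6:
  fixes m k :: nat
    and f :: "nat \<Rightarrow> real ^ 'd \<Rightarrow> ereal"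
    and x0 :: "real ^ 'd"
  assumes "1 \<le> m" and "k \<le> m"
    and "\<forall>i\<in>{1..m}. \<forall>x. f i x \<noteq> -\<infinity>"
    and "\<forall>i\<in>{1..k}. polyhedrally_convex (f i)"
    and "\<forall>j\<in>{k+1..m}. proper_fun (f j) \<and> econvex (f j)"
    and "x0 \<in> (\<Inter>i\<in>{1..m}. edom (f i))"
    and "\<forall>i\<in>{k+1..m}. isCont (f i) x0"
  shows "fenchel_conjugate (\<lambda>x. \<Sum>i\<in>{1..m}. f i x)
           = inf_convolution {1..m} (\<lambda>i. fenchel_conjugate (f i))
       \<and> (\<forall>z. inf_convolution_exact_at {1..m} (\<lambda>i. fenchel_conjugate (f i)) z)
       \<and> (\<forall>x. subdifferential (\<lambda>y. \<Sum>i\<in>{1..m}. f i y) x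
           = (\<Sum>i\<in>{1..m}. subdifferential (f i) x))"
proof -
  have ninf: "\<And>i x. i \<in> {1..m} \<Longrightarrow> f i x \<noteq> -\<infinity>" using assms(3) by blast
  have x0: "\<And>i. i \<in> {1..m} \<Longrightarrow> f i x0 < \<infinity>" using assms(6) unfolding edom_def by blast
  have dec: "affine_minorants_decompose {1..m} f"
    using ninf x0 assms(4,5,7)
    by (intro affine_minorants_decompose_polyhedral_continuous[where k = k and ?x0.0 = x0]) auto
  have I: "finite {1..m}" "{1..m} \<noteq> {}" using assms(1) by auto
  show ?thesis
    using fenchel_conjugate_sum[OF dec I] subdifferential_sum[OF dec I(1)] ninf x0
    by (intro conjI allI ext) blast+
qed

end
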